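(* Let $R$ be $\mathbb{C}$ or another commutative ring. Let $A_1,A_2,\ldots,A_k$ be $m\times m$ unitary matrices over $R$ and let $U=(u_{ij})$ be a unitary $k\times k$ matrix over $R$. Then $$\begin{pmatrix} A_1u_{11} & A_2u_{12} & \cdots & A_ku_{1k}\\ A_1u_{21} & A_2u_{22} & \cdots & A_ku_{2k}\\ \vdots & \vdots & & \vdots\\ A_1u_{k1} & A_2u_{k2} & \cdots & A_ku_{kk}\end{pmatrix}\quad\text{and}\quad \begin{pmatrix} A_1u_{11} & A_1u_{12} & \cdots & A_1u_{1k}\\ A_2u_{21} & A_2u_{22} & \cdots & A_2u_{2k}\\ \vdots & \vdots & & \vdots\\ A_ku_{k1} & A_ku_{k2} & \cdots & A_ku_{kk}\end{pmatrix}$$ are unitary $mk\times mk$ matrices.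
   Context: For a matrix $A$ over $\mathbb{C}$, $A^*$ denotes the complex conjugate transpose; over other rings, by convention, $A^*=A^{T}$ is the transpose. An $n\times n$ matrix $A$ is unitary if $AA^*=I_n$. *)

theory Defs
  imports "Jordan_Normal_Form.Schur_Decomposition"
begin

text \<open>Unitarity over the complex numbers, where the star of a matrix is its conjugate transpose.\<close>

definition unitary_complex :: "nat \<Rightarrow> complex mat \<Rightarrow> bool" where
  "unitary_complex n A \<longleftrightarrow> A \<in> carrier_mat n n \<and> A * mat_adjoint A = 1\<^sub>m n"

text \<open>Unitarity over any other commutative ring, where by convention the star of a matrix is its
  transpose. The sort describes commutative rings with unit; unlike \<^class>\<open>comm_ring_1\<close> it does not
  exclude the zero ring.\<close>

definition unitary_transpose :: "nat \<Rightarrow> 'a :: {comm_ring, comm_monoid_mult} mat \<Rightarrow> bool" where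
  "unitary_transpose n A \<longleftrightarrow> A \<in> carrier_mat n n \<and> A * transpose_mat A = 1\<^sub>m n"

text \<open>The matrix of size \<open>m * k\<close> composed of \<open>k * k\<close> blocks, where \<open>B i j\<close> is the block of size
  \<open>m * m\<close> in block row \<open>i\<close> and block column \<open>j\<close> (all indices start at 0).\<close>

definition block_mat :: "nat \<Rightarrow> nat \<Rightarrow> (nat \<Rightarrow> nat \<Rightarrow> 'a mat) \<Rightarrow> 'a mat" where
  "block_mat m k B =
     mat (m * k) (m * k) (\<lambda>(r, c). B (r div m) (c div m) $$ (r mod m, c mod m))"

end

theory Submission
  imports Defs
begin

text \<open>Unitarity says that the rows are orthonormal for the form
  \<open>\<langle>x, y\<rangle> = (\<Sum>q. x\<^sub>q * \<sigma> y\<^sub>q)\<close>, where \<open>\<sigma>\<close> is conjugation over the complex numbers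
  and the identity over other rings. Only the multiplicativity of \<open>\<sigma>\<close> matters, so both cases follow
  from one argument about \<open>orthonormal_rows \<sigma>\<close>.

  Let \<open>(i, a)\<close> and \<open>(i', b)\<close> be the block row and the position in the block of two rows. Summing
  block by block and collecting the factors from \<open>U\<close> and from the \<open>A\<close>'s turns their product into
  \<open>\<Sum>j. (u\<^sub>i\<^sub>j * \<sigma> u\<^sub>i\<^sub>'\<^sub>j) * \<langle>row a of X, row b of Y\<rangle>\<close>. In the first block matrix
  \<open>X = Y = A\<^sub>j\<close>, so the second factor is \<open>\<delta>\<^sub>a\<^sub>b\<close> by orthonormality inside \<open>A\<^sub>j\<close>, and the remaining sum is
  \<open>\<delta>\<^sub>i\<^sub>i\<^sub>'\<close> by orthonormality of \<open>U\<close>. In the second one \<open>X = A\<^sub>i\<close> and \<open>Y = A\<^sub>i\<^sub>'\<close> do not depend on \<open>j\<close>, so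
  the sum over \<open>j\<close> comes first: it is \<open>\<delta>\<^sub>i\<^sub>i\<^sub>'\<close>, and rows of the two different matrices \<open>A\<^sub>i\<close> and
  \<open>A\<^sub>i\<^sub>'\<close>, about whose product nothing is known, are multiplied by 0.\<close>

definition orthonormal_rows ::
  "('a \<Rightarrow> 'a) \<Rightarrow> nat \<Rightarrow> 'a :: {comm_semiring_0, comm_monoid_mult} mat \<Rightarrow> bool" where
  "orthonormal_rows \<sigma> n A \<longleftrightarrow> A \<in> carrier_mat n n \<and>
     (\<forall>i<n. \<forall>j<n. (\<Sum>q<n. A $$ (i, q) * \<sigma> (A $$ (j, q))) = (if i = j then 1 else 0))"

lemma unitary_complex_iff_orthonormal_rows:
  "unitary_complex n A \<longleftrightarrow> orthonormal_rows cnj n A"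
proof (cases "A \<in> carrier_mat n n")
  case True
  have "A * mat_adjoint A = 1\<^sub>m n \<longleftrightarrow>
      (\<forall>i<n. \<forall>j<n. (\<Sum>q<n. A $$ (i, q) * cnj (A $$ (j, q))) = (if i = j then 1 else 0))"
    using True
    by (auto simp: mat_eq_iff mat_adjoint_def scalar_prod_def mat_of_rows_def atLeast0LessThan)
  with True show ?thesis by (simp add: unitary_complex_def orthonormal_rows_def)
qed (simp add: unitary_complex_def orthonormal_rows_def)

lemma unitary_transpose_iff_orthonormal_rows:
  "unitary_transpose n A \<longleftrightarrow> orthonormal_rows (\<lambda>x. x) n A"
proof (cases "A \<in> carrier_mat n n")
  case True
  have "A * transpose_mat A = 1\<^sub>m n \<longleftrightarrow>
      (\<forall>i<n. \<forall>j<n. (\<Sum>q<n. A $$ (i, q) * A $$ (j, q)) = (if i = j then 1 else 0))"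
    using True by (auto simp: mat_eq_iff scalar_prod_def atLeast0LessThan)
  with True show ?thesis by (simp add: unitary_transpose_def orthonormal_rows_def)
qed (simp add: unitary_transpose_def orthonormal_rows_def)

lemma sum_lessThan_mult_div_mod:
  fixes f :: "nat \<Rightarrow> nat \<Rightarrow> 'a :: comm_monoid_add"
  shows "(\<Sum>q<m * k. f (q div m) (q mod m)) = (\<Sum>j<k. \<Sum>t<m. f j t)"
proof -
  have "(\<Sum>q<m * k. f (q div m) (q mod m))
      = (\<Sum>j<k. \<Sum>q = j * m..<j * m + m. f (q div m) (q mod m))"
    by (simp add: sum.nat_group mult.commute)
  also have "\<dots> = (\<Sum>j<k. \<Sum>t<m. f j t)"
  proof (rule sum.cong[OF refl])
    fix j
    have "(\<Sum>q = j * m..<j * m + m. f (q div m) (q mod m))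
        = (\<Sum>t<m. f ((t + j * m) div m) ((t + j * m) mod m))"
      using sum.shift_bounds_nat_ivl[of "\<lambda>q. f (q div m) (q mod m)" 0 "j * m" m]
      by (simp add: atLeast0LessThan add.commute)
    also have "\<dots> = (\<Sum>t<m. f j t)" by (rule sum.cong) auto
    finally show "(\<Sum>q = j * m..<j * m + m. f (q div m) (q mod m)) = (\<Sum>t<m. f j t)" .
  qed
  finally show ?thesis .
qed

text \<open>Both block matrices are instances: \<open>C i j\<close> is \<open>A j\<close> in one and \<open>A i\<close> in the other. The
  last hypothesis is what orthonormality becomes when the sum over all columns is split
  into blocks.\<close>

lemma orthonormal_rows_block_matI:
  fixes \<sigma> :: "'a :: {comm_semiring_0, comm_monoid_mult} \<Rightarrow> 'a"
  assumes mult: "\<And>x y. \<sigma> (x * y) = \<sigma> x * \<sigma> y"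
    and carrier: "\<And>i j. i < k \<Longrightarrow> j < k \<Longrightarrow> C i j \<in> carrier_mat m m"
    and blocks: "\<And>i i' a b. i < k \<Longrightarrow> i' < k \<Longrightarrow> a < m \<Longrightarrow> b < m \<Longrightarrow>
      (\<Sum>j<k. (U $$ (i, j) * \<sigma> (U $$ (i', j))) *
        (\<Sum>t<m. C i j $$ (a, t) * \<sigma> (C i' j $$ (b, t)))) = (if i = i' \<and> a = b then 1 else 0)"
  shows "orthonormal_rows \<sigma> (m * k) (block_mat m k (\<lambda>i j. U $$ (i, j) \<cdot>\<^sub>m C i j))"
    (is "orthonormal_rows _ _ ?B")
  unfolding orthonormal_rows_def
proof (intro conjI allI impI)
  show "?B \<in> carrier_mat (m * k) (m * k)" by (simp add: block_mat_def)
next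
  fix r c assume r: "r < m * k" and c: "c < m * k"
  have bounds: "q div m < k" "q mod m < m" if "q < m * k" for q
    using that by (cases m; simp add: less_mult_imp_div_less mult.commute)+
  have entry: "?B $$ (p, q) =
      U $$ (p div m, q div m) * C (p div m) (q div m) $$ (p mod m, q mod m)"
    if "p < m * k" "q < m * k" for p q
    using that bounds[OF that(1)] bounds[OF that(2)] carrier[of "p div m" "q div m"]
    by (simp add: block_mat_def)
  have "(\<Sum>q<m * k. ?B $$ (r, q) * \<sigma> (?B $$ (c, q)))
      = (\<Sum>q<m * k. (U $$ (r div m, q div m) * \<sigma> (U $$ (c div m, q div m))) *
          (C (r div m) (q div m) $$ (r mod m, q mod m) *
            \<sigma> (C (c div m) (q div m) $$ (c mod m, q mod m))))"
    using r c by (intro sum.cong refl) (simp add: entry mult mult_ac)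
  also have "\<dots> = (\<Sum>j<k. (U $$ (r div m, j) * \<sigma> (U $$ (c div m, j))) *
      (\<Sum>t<m. C (r div m) j $$ (r mod m, t) * \<sigma> (C (c div m) j $$ (c mod m, t))))"
    by (subst sum_lessThan_mult_div_mod) (simp add: sum_distrib_left)
  also have "\<dots> = (if r div m = c div m \<and> r mod m = c mod m then 1 else 0)"
    using r c by (intro blocks bounds)
  also have "r div m = c div m \<and> r mod m = c mod m \<longleftrightarrow> r = c"
    by (metis div_mult_mod_eq)
  finally show "(\<Sum>q<m * k. ?B $$ (r, q) * \<sigma> (?B $$ (c, q))) = (if r = c then 1 else 0)" .
qed

lemma orthonormal_rows_block_mat_columnwise:
  fixes \<sigma> :: "'a :: {comm_semiring_0, comm_monoid_mult} \<Rightarrow> 'a"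
  assumes mult: "\<And>x y. \<sigma> (x * y) = \<sigma> x * \<sigma> y"
    and A: "\<And>j. j < k \<Longrightarrow> orthonormal_rows \<sigma> m (A j)" and U: "orthonormal_rows \<sigma> k U"
  shows "orthonormal_rows \<sigma> (m * k) (block_mat m k (\<lambda>i j. U $$ (i, j) \<cdot>\<^sub>m A j))"
proof (rule orthonormal_rows_block_matI[OF mult])
  fix i i' a b assume *: "i < k" "i' < k" "a < m" "b < m"
  have "(\<Sum>j<k. (U $$ (i, j) * \<sigma> (U $$ (i', j))) * (\<Sum>t<m. A j $$ (a, t) * \<sigma> (A j $$ (b, t))))
      = (\<Sum>j<k. U $$ (i, j) * \<sigma> (U $$ (i', j)) * (if a = b then 1 else 0))"
    using A * by (intro sum.cong refl) (simp add: orthonormal_rows_def)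
  also have "\<dots> = (if i = i' \<and> a = b then 1 else 0)"
    using U * by (simp add: orthonormal_rows_def)
  finally show "(\<Sum>j<k. (U $$ (i, j) * \<sigma> (U $$ (i', j))) *
      (\<Sum>t<m. A j $$ (a, t) * \<sigma> (A j $$ (b, t)))) = (if i = i' \<and> a = b then 1 else 0)" .
qed (use A in \<open>simp add: orthonormal_rows_def\<close>)

lemma orthonormal_rows_block_mat_rowwise:
  fixes \<sigma> :: "'a :: {comm_semiring_0, comm_monoid_mult} \<Rightarrow> 'a"
  assumes mult: "\<And>x y. \<sigma> (x * y) = \<sigma> x * \<sigma> y"
    and A: "\<And>i. i < k \<Longrightarrow> orthonormal_rows \<sigma> m (A i)" and U: "orthonormal_rows \<sigma> k U"
  shows "orthonormal_rows \<sigma> (m * k) (block_mat m k (\<lambda>i j. U $$ (i, j) \<cdot>\<^sub>m A i))"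
proof (rule orthonormal_rows_block_matI[OF mult])
  fix i i' a b assume *: "i < k" "i' < k" "a < m" "b < m"
  have "(\<Sum>j<k. (U $$ (i, j) * \<sigma> (U $$ (i', j))) * (\<Sum>t<m. A i $$ (a, t) * \<sigma> (A i' $$ (b, t))))
      = (\<Sum>j<k. U $$ (i, j) * \<sigma> (U $$ (i', j))) * (\<Sum>t<m. A i $$ (a, t) * \<sigma> (A i' $$ (b, t)))"
    by (rule sum_distrib_right[symmetric])
  also have "\<dots> = (if i = i' then 1 else 0) * (\<Sum>t<m. A i $$ (a, t) * \<sigma> (A i' $$ (b, t)))"
    using U * by (simp add: orthonormal_rows_def)
  also have "\<dots> = (if i = i' \<and> a = b then 1 else 0)"
    using A[of i] * by (auto simp: orthonormal_rows_def)
  finally show "(\<Sum>j<k. (U $$ (i, j) * \<sigma> (U $$ (i', j))) *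
      (\<Sum>t<m. A i $$ (a, t) * \<sigma> (A i' $$ (b, t)))) = (if i = i' \<and> a = b then 1 else 0)" .
qed (use A in \<open>simp add: orthonormal_rows_def\<close>)

theorem proposition2p5:
  fixes m k :: nat
  shows
    "(\<forall>(A :: nat \<Rightarrow> complex mat) (U :: complex mat).
        (\<forall>i<k. unitary_complex m (A i)) \<and> unitary_complex k U \<longrightarrow>
          unitary_complex (m * k) (block_mat m k (\<lambda>i j. U $$ (i, j) \<cdot>\<^sub>m A j)) \<and>
          unitary_complex (m * k) (block_mat m k (\<lambda>i j. U $$ (i, j) \<cdot>\<^sub>m A i))) \<and>
     (\<forall>(A :: nat \<Rightarrow> 'a :: {comm_ring, comm_monoid_mult} mat) (U :: 'a mat).
        (\<forall>i<k. unitary_transpose m (A i)) \<and> unitary_transpose k U \<longrightarrow>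
          unitary_transpose (m * k) (block_mat m k (\<lambda>i j. U $$ (i, j) \<cdot>\<^sub>m A j)) \<and>
          unitary_transpose (m * k) (block_mat m k (\<lambda>i j. U $$ (i, j) \<cdot>\<^sub>m A i)))"
  unfolding unitary_complex_iff_orthonormal_rows unitary_transpose_iff_orthonormal_rows
  by (auto intro!: orthonormal_rows_block_mat_columnwise orthonormal_rows_block_mat_rowwise)

end
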